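(* Let $1\le c\le n+1$ and let $I_{n+1,c}\subseteq R=k[x_0,\ldots,x_n]$ be the Stanley–Reisner ideal of the $(n-c)$-dimensional uniform matroid on $n+1$ vertices. Then its Waldschmidt constant is $$\widehat\alpha(I_{n+1,c})=\frac{n+1}{c}.$$
   Context: $k$ is an algebraically closed field of any characteristic. The $(n-c)$-dimensional uniform matroid on $n+1$ vertices is the simplicial complex $\Delta$ on $n+1$ vertices whose facets are all subsets of the vertex set of cardinality $n+1-c$. Its Stanley–Reisner ideal $I_{n+1,c}$ (generated by the squarefree monomials corresponding to non-faces) is generated by all squarefree monomials of degree $n+2-c$ in $R$; equivalently $I_{n+1,c}=\bigcap_{0\le i_1<i_2<\cdots<i_c\le n}(x_{i_1},x_{i_2},\ldots,x_{i_c})$. For a nonzero homogeneous ideal $J\subseteq R$: $\alpha(J)$ is the smallest degree of a nonzero element of $J$; the $m$-th symbolic power is $J^{(m)}=\bigcap_{P\in \mathrm{Ass}(J)}(J^mR_P\cap R)$; the Waldschmidt constant is $\widehat\alpha(J)=\lim_{m\to\infty}\alpha(J^{(m)})/m$ (the limit exists). *)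

theory Defs
  imports
    Complex_Main
    "HOL-Library.Cardinality"
    "HOL-Library.Poly_Mapping"
    "HOL-Computational_Algebra.Computational_Algebra"
begin

type_synonym ('v, 'k) mpoly_ring = "('v \<Rightarrow>\<^sub>0 nat) \<Rightarrow>\<^sub>0 'k"

text \<open>
  The polynomial ring \<open>k[x\<^sub>0, \<dots>, x\<^sub>n]\<close> is the type \<open>('v, 'k) mpoly_ring\<close> for a finite type
  \<^typ>\<open>'v\<close> with \<open>n + 1\<close> elements: finitely supported functions from monomials (exponent vectors)
  to \<^typ>\<open>'k\<close>, multiplied by convolution. The class \<^class>\<open>linorder\<close> on \<^typ>\<open>'v\<close>, a linear ordering of
  the variables, is only needed because the library's \<^class>\<open>idom\<close> instance asks for it.
\<close>

definition indet :: "'v \<Rightarrow> ('v, 'k::comm_ring_1) mpoly_ring" where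
  "indet i = Poly_Mapping.single (Poly_Mapping.single i 1) 1"

definition monomial_degree :: "('v \<Rightarrow>\<^sub>0 nat) \<Rightarrow> nat" where
  "monomial_degree t = (\<Sum>i\<in>Poly_Mapping.keys t. Poly_Mapping.lookup t i)"

text \<open>Only meaningful for nonzero polynomials, the only ones it is used for.\<close>

definition total_degree :: "('v, 'k::zero) mpoly_ring \<Rightarrow> nat" where
  "total_degree f = Max (monomial_degree ` Poly_Mapping.keys f)"


section \<open>Ideals and symbolic powers\<close>

text \<open>
  Ideals of a commutative ring are its submodules as a module over itself: \<open>ideal.subspace J\<close>
  says that \<open>J\<close> is an ideal, and \<open>ideal.span S\<close> is the ideal generated by \<open>S\<close>.
\<close>

global_interpretation ideal: module "(*) :: 'a::comm_ring_1 \<Rightarrow> 'a \<Rightarrow> 'a"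
  by unfold_locales (simp_all add: algebra_simps)

definition prime_ideal :: "'a::comm_ring_1 set \<Rightarrow> bool" where
  "prime_ideal P \<longleftrightarrow>
     ideal.subspace P \<and> P \<noteq> UNIV \<and> (\<forall>a b. a * b \<in> P \<longrightarrow> a \<in> P \<or> b \<in> P)"

text \<open>\<open>Ass(J)\<close> denotes the associated primes of the module \<open>R/J\<close>, that is, the prime ideals which
  are the annihilator of the class of some \<open>f\<close> in \<open>R/J\<close>.\<close>

definition Ass :: "'a::comm_ring_1 set \<Rightarrow> 'a set set" where
  "Ass J = {P. prime_ideal P \<and> (\<exists>f. P = {g. g * f \<in> J})}"

fun ideal_power :: "'a::comm_ring_1 set \<Rightarrow> nat \<Rightarrow> 'a set" where
  "ideal_power J 0 = UNIV"
| "ideal_power J (Suc m) = ideal.span {a * b |a b. a \<in> J \<and> b \<in> ideal_power J m}"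

text \<open>For a domain \<open>R\<close>, both \<open>R\<close> and the localisation \<open>R\<^sub>P\<close> are regarded as subrings of the field of
  fractions of \<open>R\<close>.\<close>

definition localization :: "'a::idom set \<Rightarrow> 'a fract set" where
  "localization P = {Fraction_Field.Fract a s |a s. s \<notin> P}"

text \<open>\<open>extended_ideal J P\<close> is \<open>J R\<^sub>P\<close>, the ideal of \<open>R\<^sub>P\<close> generated by \<open>J\<close>.\<close>

definition extended_ideal :: "'a::idom set \<Rightarrow> 'a set \<Rightarrow> 'a fract set" where
  "extended_ideal J P =
     {(\<Sum>i<N. r i * Fraction_Field.Fract (a i) 1) |(N::nat) r a.
        \<forall>i<N. r i \<in> localization P \<and> a i \<in> J}"

definition symbolic_power :: "'a::idom set \<Rightarrow> nat \<Rightarrow> 'a set" where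
  "symbolic_power J m =
     (\<Inter>P\<in>Ass J. {f. Fraction_Field.Fract f 1 \<in> extended_ideal (ideal_power J m) P})"


section \<open>The Waldschmidt constant\<close>

definition alpha :: "('v, 'k::zero) mpoly_ring set \<Rightarrow> nat" where
  "alpha J = (LEAST d. \<exists>f\<in>J. f \<noteq> 0 \<and> total_degree f = d)"

definition waldschmidt_seq :: "('v::linorder, 'k::idom) mpoly_ring set \<Rightarrow> nat \<Rightarrow> real" where
  "waldschmidt_seq J m = real (alpha (symbolic_power J m)) / real m"

definition waldschmidt_constant :: "('v::linorder, 'k::idom) mpoly_ring set \<Rightarrow> real" where
  "waldschmidt_constant J = lim (waldschmidt_seq J)"


section \<open>Uniform matroids and Stanley--Reisner ideals\<close>

text \<open>The simplicial complex on the vertex set \<^typ>\<open>'v\<close> whose facets are all sets of cardinality \<open>r\<close>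
  (see \<open>facets_uniform_matroid\<close> below); its dimension is \<open>r - 1\<close>.\<close>

definition uniform_matroid :: "nat \<Rightarrow> 'v::finite set set" where
  "uniform_matroid r = {F. \<exists>G. card G = r \<and> F \<subseteq> G}"

definition facets :: "'v set set \<Rightarrow> 'v set set" where
  "facets \<Delta> = {F \<in> \<Delta>. \<forall>G\<in>\<Delta>. F \<subseteq> G \<longrightarrow> G = F}"

lemma facets_uniform_matroid:
  assumes "r \<le> CARD('v)"
  shows "facets (uniform_matroid r) = {F :: 'v::finite set. card F = r}"
proof (intro equalityI subsetI)
  fix F :: "'v set" assume "F \<in> facets (uniform_matroid r)"
  then show "F \<in> {F. card F = r}"
    unfolding facets_def uniform_matroid_def by blast
next
  fix F :: "'v set" assume F: "F \<in> {F. card F = r}"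
  have "G = F" if "G \<in> uniform_matroid r" "F \<subseteq> G" for G
  proof -
    from that(1) obtain H where "card H = r" "G \<subseteq> H"
      unfolding uniform_matroid_def by blast
    with F that(2) have "F = H"
      by (intro card_subset_eq) auto
    with \<open>G \<subseteq> H\<close> that(2) show ?thesis by blast
  qed
  with F show "F \<in> facets (uniform_matroid r)"
    unfolding facets_def uniform_matroid_def by blast
qed

definition stanley_reisner_ideal ::
    "'v::finite set set \<Rightarrow> ('v, 'k::comm_ring_1) mpoly_ring set" where
  "stanley_reisner_ideal \<Delta> = ideal.span {(\<Prod>i\<in>F. indet i) |F. F \<notin> \<Delta>}"

end

theory Submission
  imports Defs
begin

text \<open>
  Write \<open>N = n + 1\<close>. For a set \<open>S\<close> of \<open>c\<close> variables, the order of vanishing along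
  \<open>P\<^sub>S = (x\<^sub>i | i \<in> S)\<close> is the least \<open>S\<close>-degree of a monomial; it is additive on products. As \<open>P\<^sub>S\<close>
  is an associated prime of \<open>I\<close>, all monomials of an element of \<open>I\<^sup>(\<^sup>m\<^sup>)\<close> have \<open>S\<close>-degree at least
  \<open>m\<close>, and averaging over all \<open>S\<close> bounds their degree below by \<open>m N / c\<close>. Conversely, an associated
  prime contains exactly \<open>c\<close> variables, so that \<open>(x\<^sub>0 \<cdots> x\<^sub>n)\<^sup>q \<in> I\<^sup>(\<^sup>m\<^sup>)\<close> whenever \<open>c q \<ge> m\<close>.
\<close>

text \<open>Reassociates products to the left, so that it loops with \<open>ac_simps\<close> and \<open>algebra_simps\<close>.\<close>

declare ideal.scale_scale [simp del]

section \<open>Ideals cut out by conditions on monomials\<close>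

text \<open>One shape for several ideals: with the \<open>S\<close>-degree as \<open>w\<close> these
  are the powers of \<open>P\<^sub>S\<close>, the prime itself at \<open>m = 1\<close>; with the
  size of the support as \<open>w\<close> they include the Stanley-Reisner ideal.\<close>

definition weight_ideal :: "(('v \<Rightarrow>\<^sub>0 nat) \<Rightarrow> nat) \<Rightarrow> nat \<Rightarrow> ('v, 'k::comm_ring_1) mpoly_ring set" where
  "weight_ideal w m = {f. \<forall>t\<in>Poly_Mapping.keys f. m \<le> w t}"

lemma subspace_weight_ideal:
  assumes "\<And>s t. w t \<le> w (s + t)"
  shows "ideal.subspace (weight_ideal w m :: ('v, 'k::comm_ring_1) mpoly_ring set)"
proof (rule ideal.subspaceI)
  fix f g :: "('v, 'k) mpoly_ring"
  assume "f \<in> weight_ideal w m" "g \<in> weight_ideal w m"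
  then show "f + g \<in> weight_ideal w m"
    using Poly_Mapping.keys_add[of f g] by (auto simp: weight_ideal_def)
next
  fix f g :: "('v, 'k) mpoly_ring"
  assume "g \<in> weight_ideal w m"
  then show "f * g \<in> weight_ideal w m"
    using keys_mult[of f g] order_trans[OF _ assms] unfolding weight_ideal_def by blast
qed (simp add: weight_ideal_def)

lemma weight_ideal_mult:
  assumes "\<And>s t. w (s + t) = w s + w t"
    and "f \<in> weight_ideal w l" "g \<in> weight_ideal w m"
  shows "f * g \<in> weight_ideal w (l + m)"
proof -
  have "l + m \<le> w (s + t)" if "s \<in> Poly_Mapping.keys f" "t \<in> Poly_Mapping.keys g" for s t
    using assms that by (auto simp: weight_ideal_def intro: add_mono)
  then show ?thesis
    using keys_mult[of f g] unfolding weight_ideal_def by blast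
qed

lemma ideal_power_subset_weight_ideal:
  assumes "\<And>s t. w (s + t) = w s + w t" and "J \<subseteq> weight_ideal w 1"
  shows "ideal_power J m \<subseteq> weight_ideal w m"
proof (induction m)
  case 0
  show ?case by (auto simp: weight_ideal_def)
next
  case (Suc m)
  have "a * b \<in> weight_ideal w (Suc m)" if "a \<in> J" "b \<in> ideal_power J m" for a b
    using weight_ideal_mult[of w a 1 b m] that assms Suc.IH by auto
  then show ?case
    unfolding ideal_power.simps
    by (intro ideal.span_minimal subspace_weight_ideal) (auto simp: assms(1))
qed

definition weight_part :: "(('v \<Rightarrow>\<^sub>0 nat) \<Rightarrow> nat) \<Rightarrow> nat \<Rightarrow> ('v, 'k::comm_ring_1) mpoly_ring
    \<Rightarrow> ('v, 'k) mpoly_ring" where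
  "weight_part w d f = (\<Sum>t\<in>{t\<in>Poly_Mapping.keys f. w t = d}.
     Poly_Mapping.single t (Poly_Mapping.lookup f t))"

lemma lookup_weight_part:
  "Poly_Mapping.lookup (weight_part w d f) t = (if w t = d then Poly_Mapping.lookup f t else 0)"
  by (auto simp: weight_part_def lookup_sum lookup_single when_def in_keys_iff)

text \<open>The minimal weight of a product is the sum of the minimal weights of the factors, because
  the product of their parts of minimal weight is nonzero in a domain.\<close>

lemma weight_ideal_cancel:
  fixes f g :: "('v::linorder, 'k::idom) mpoly_ring"
  assumes add: "\<And>s t. w (s + t) = w s + w t"
    and g: "g \<notin> weight_ideal w 1" and gf: "g * f \<in> weight_ideal w m"
  shows "f \<in> weight_ideal w m"
proof (cases "f = 0")
  case True
  then show ?thesis by (simp add: weight_ideal_def)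
next
  case False
  define d where "d = Min (w ` Poly_Mapping.keys f)"
  have "d \<in> w ` Poly_Mapping.keys f"
    unfolding d_def using False by (intro Min_in) auto
  then obtain t where t: "t \<in> Poly_Mapping.keys f" "w t = d" by auto
  have d_le: "d \<le> w u" if "u \<in> Poly_Mapping.keys f" for u
    unfolding d_def using that by (intro Min_le) auto
  \<comment> \<open>Outside the ideal of weight \<open>1\<close>, \<open>g\<close> must have a
    monomial of weight \<open>0\<close>, so its minimal weight is \<open>0\<close>.\<close>
  obtain s where s: "s \<in> Poly_Mapping.keys g" "w s = 0"
    using g by (auto simp: weight_ideal_def not_le)
  define f0 where "f0 = weight_part w d f"
  define g0 where "g0 = weight_part w 0 g"
  have "Poly_Mapping.lookup f0 t \<noteq> 0" "Poly_Mapping.lookup g0 s \<noteq> 0"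
    using t s by (auto simp: f0_def g0_def lookup_weight_part in_keys_iff)
  then have "g0 * f0 \<noteq> 0" by auto
  then obtain u where u: "u \<in> Poly_Mapping.keys (g0 * f0)"
    by (meson ex_in_conv keys_eq_empty)
  have f0: "w v = d" if "v \<in> Poly_Mapping.keys f0" for v
    using that by (auto simp: f0_def lookup_weight_part in_keys_iff split: if_splits)
  have g0: "w v = 0" if "v \<in> Poly_Mapping.keys g0" for v
    using that by (auto simp: g0_def lookup_weight_part in_keys_iff split: if_splits)
  have wu: "w u = d"
    using u keys_mult[of g0 f0] f0 g0 add by fastforce
  have f1: "f - f0 \<in> weight_ideal w (Suc d)"
    using d_le by (force simp: weight_ideal_def f0_def lookup_weight_part lookup_minus in_keys_iff
      le_less Suc_le_eq split: if_splits)
  have g1: "g - g0 \<in> weight_ideal w 1"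
    by (force simp: weight_ideal_def g0_def lookup_weight_part lookup_minus in_keys_iff
      Suc_le_eq split: if_splits)
  have "f \<in> weight_ideal w d" using d_le by (simp add: weight_ideal_def)
  then have a: "(g - g0) * f \<in> weight_ideal w (Suc d)"
    using weight_ideal_mult[OF add g1, of f d] by simp
  have "g0 \<in> weight_ideal w 0" by (simp add: weight_ideal_def)
  then have b: "g0 * (f - f0) \<in> weight_ideal w (Suc d)"
    using weight_ideal_mult[OF add _ f1, of g0 0] by simp
  \<comment> \<open>Both correction terms have all weights above \<open>d\<close>, so a monomial
    \<open>u\<close> of \<open>g0 * f0\<close>, which has weight \<open>d\<close>, survives in
    \<open>g * f\<close> and forces \<open>m \<le> d\<close>.\<close>
  have "g * f = g0 * f0 + ((g - g0) * f + g0 * (f - f0))"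
    by (simp add: algebra_simps)
  moreover have "(g - g0) * f + g0 * (f - f0) \<in> weight_ideal w (Suc d)"
    by (rule ideal.subspace_add[OF subspace_weight_ideal a b]) (simp add: add)
  then have "u \<notin> Poly_Mapping.keys ((g - g0) * f + g0 * (f - f0))"
    using wu by (auto simp: weight_ideal_def)
  ultimately have "u \<in> Poly_Mapping.keys (g * f)"
    using u by (simp add: in_keys_iff lookup_add)
  then have "m \<le> d" using gf wu by (auto simp: weight_ideal_def)
  then show ?thesis using d_le by (auto simp: weight_ideal_def intro: order_trans)
qed

text \<open>Primality is the case \<open>m = 1\<close> of \<open>weight_ideal_cancel\<close>;
  properness holds because additivity gives the monomial of \<open>1\<close> weight
  \<open>0\<close>.\<close>

lemma prime_ideal_weight_ideal:
  assumes add: "\<And>s t. w (s + t) = w s + w t"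
  shows "prime_ideal (weight_ideal w 1 :: ('v::linorder, 'k::idom) mpoly_ring set)"
  unfolding prime_ideal_def
proof (intro conjI allI impI)
  show "ideal.subspace (weight_ideal w 1 :: ('v, 'k) mpoly_ring set)"
    by (rule subspace_weight_ideal) (simp add: add)
  have "w 0 = 0" using add[of 0 0] by simp
  then have "(1 :: ('v, 'k) mpoly_ring) \<notin> weight_ideal w 1"
    by (simp add: weight_ideal_def)
  then show "(weight_ideal w 1 :: ('v, 'k) mpoly_ring set) \<noteq> UNIV" by blast
  fix f g :: "('v, 'k) mpoly_ring"
  assume "f * g \<in> weight_ideal w 1"
  then show "f \<in> weight_ideal w 1 \<or> g \<in> weight_ideal w 1"
    using weight_ideal_cancel[OF add] by blast
qed

section \<open>Powers of ideals and localisation\<close>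

lemma subspace_ideal_power: "ideal.subspace (ideal_power J m)"
  by (cases m) (simp_all add: ideal.subspace_span ideal.subspace_UNIV)

lemma ideal_power_Suc_mult: "a \<in> J \<Longrightarrow> b \<in> ideal_power J m \<Longrightarrow> a * b \<in> ideal_power J (Suc m)"
  by (auto intro!: ideal.span_base)

lemma ideal_power_mult_power:
  "a \<in> J \<Longrightarrow> b \<in> ideal_power J m \<Longrightarrow> a ^ q * b \<in> ideal_power J (q + m)"
proof (induction q)
  case (Suc q)
  then show ?case
    using ideal_power_Suc_mult[of a J "a ^ q * b" "q + m"] by (simp add: mult.assoc)
qed simp

lemma prod_power_in_ideal_power:
  assumes "finite A" "\<And>i. i \<in> A \<Longrightarrow> a i \<in> J"
  shows "(\<Prod>i\<in>A. a i ^ q) \<in> ideal_power J (card A * q)"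
  using assms
proof (induction A rule: finite_induct)
  case (insert x A)
  then show ?case
    using ideal_power_mult_power[of "a x" J "\<Prod>i\<in>A. a i ^ q" "card A * q" q] by simp
qed simp

lemma ideal_power_antimono:
  assumes "m \<le> l"
  shows "ideal_power J l \<subseteq> ideal_power J m"
proof -
  have "ideal_power J (Suc j) \<subseteq> ideal_power J j" for j
    unfolding ideal_power.simps(2)
    by (intro ideal.span_minimal subspace_ideal_power)
       (auto intro: ideal.subspace_scale[OF subspace_ideal_power])
  then show ?thesis using assms by (rule lift_Suc_antimono_le)
qed

text \<open>The empty product is included on purpose: with \<open>A = {}\<close> this says
  \<open>1 \<notin> P\<close>, and it is used below in that form too.\<close>

lemma prime_ideal_prod:
  assumes "prime_ideal P" "finite A" "\<And>i. i \<in> A \<Longrightarrow> a i \<notin> P"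
  shows "(\<Prod>i\<in>A. a i) \<notin> P"
  using assms(2,3)
proof (induction A rule: finite_induct)
  case empty
  show ?case
  proof
    assume "(\<Prod>i\<in>{}. a i) \<in> P"
    then have "b \<in> P" for b
      using assms(1) ideal.subspace_scale[of P 1 b] by (auto simp: prime_ideal_def)
    then show False using assms(1) by (auto simp: prime_ideal_def)
  qed
next
  case (insert x A)
  then show ?case using assms(1) by (auto simp: prime_ideal_def)
qed

text \<open>Clearing denominators turns membership in the extended ideal into a statement inside the
  ring itself.\<close>

lemma Fract_in_extended_ideal_iff:
  fixes P J :: "'a::idom set"
  assumes P: "prime_ideal P" and J: "ideal.subspace J"
  shows "Fraction_Field.Fract f 1 \<in> extended_ideal J P \<longleftrightarrow> (\<exists>s. s \<notin> P \<and> s * f \<in> J)"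
proof -
  have zero: "0 \<in> P" using P by (auto simp: prime_ideal_def ideal.subspace_0)
  have one: "1 \<notin> P" using prime_ideal_prod[OF P, of "{}"] by simp
  show ?thesis
  proof
    assume "Fraction_Field.Fract f 1 \<in> extended_ideal J P"
    then obtain N :: nat and r a where f: "Fraction_Field.Fract f 1 = (\<Sum>i<N. r i * Fraction_Field.Fract (a i) 1)"
      and ra: "\<forall>i<N. r i \<in> localization P \<and> a i \<in> J"
      unfolding extended_ideal_def by blast
    \<comment> \<open>Induction over the partial sums: each is one fraction with numerator in
      \<open>J\<close> and denominator outside \<open>P\<close>, since \<open>P\<close> is prime and
      so its complement is closed under products.\<close>
    have "\<exists>b s. s \<notin> P \<and> b \<in> J \<and> (\<Sum>i<M. r i * Fraction_Field.Fract (a i) 1) = Fraction_Field.Fract b s"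
      if "M \<le> N" for M
      using that
    proof (induction M)
      case 0
      then show ?case
        using one ideal.subspace_0[OF J]
        by (intro exI[of _ "0::'a"] exI[of _ "1::'a"]) (simp add: Zero_fract_def)
    next
      case (Suc M)
      then obtain b s where bs: "s \<notin> P" "b \<in> J"
        "(\<Sum>i<M. r i * Fraction_Field.Fract (a i) 1) = Fraction_Field.Fract b s"
        by auto
      from ra Suc.prems have rM: "r M \<in> localization P" and aM: "a M \<in> J" by auto
      from rM obtain x y where xy: "r M = Fraction_Field.Fract x y" "y \<notin> P"
        unfolding localization_def by blast
      have "s \<noteq> 0" "y \<noteq> 0" using bs xy zero by auto
      have "(\<Sum>i<Suc M. r i * Fraction_Field.Fract (a i) 1)
          = Fraction_Field.Fract b s + Fraction_Field.Fract x y * Fraction_Field.Fract (a M) 1"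
        by (simp only: sum.lessThan_Suc bs(3) xy(1))
      also have "\<dots> = Fraction_Field.Fract (b * y + x * a M * s) (s * y)"
        using \<open>s \<noteq> 0\<close> \<open>y \<noteq> 0\<close> by simp
      also have "b * y + x * a M * s = y * b + s * x * a M" by (simp add: algebra_simps)
      finally have sum: "(\<Sum>i<Suc M. r i * Fraction_Field.Fract (a i) 1)
          = Fraction_Field.Fract (y * b + s * x * a M) (s * y)" .
      have sy: "s * y \<notin> P" using bs xy P unfolding prime_ideal_def by blast
      have "y * b + s * x * a M \<in> J"
        using bs(2) aM J by (intro ideal.subspace_add ideal.subspace_scale)
      with sum sy show ?case by metis
    qed
    from this[OF order_refl] obtain b s where bs: "s \<notin> P" "b \<in> J"
      "Fraction_Field.Fract f 1 = Fraction_Field.Fract b s"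
      unfolding f by blast
    then have "s \<noteq> 0" using zero by auto
    with bs(3) have "s * f = b" by (simp add: eq_fract mult.commute)
    with bs show "\<exists>s. s \<notin> P \<and> s * f \<in> J" by blast
  next
    assume "\<exists>s. s \<notin> P \<and> s * f \<in> J"
    then obtain s where s: "s \<notin> P" "s * f \<in> J" by blast
    then have "s \<noteq> 0" using zero by auto
    \<comment> \<open>A single summand suffices: coefficient \<open>1/s\<close> and the element
      \<open>s * f\<close> of \<open>J\<close>.\<close>
    then have "Fraction_Field.Fract f 1 = (\<Sum>i<1::nat. Fraction_Field.Fract 1 s * Fraction_Field.Fract (s * f) 1)"
      by (simp add: eq_fract)
    with s show "Fraction_Field.Fract f 1 \<in> extended_ideal J P"
      unfolding extended_ideal_def localization_def
      by (intro CollectI exI[of _ "1::nat"] exI[of _ "\<lambda>_. Fraction_Field.Fract 1 s"] exI[of _ "\<lambda>_. s * f"]) auto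
  qed
qed

lemma mem_symbolic_power_iff:
  "f \<in> symbolic_power J m \<longleftrightarrow> (\<forall>P\<in>Ass J. \<exists>s. s \<notin> P \<and> s * f \<in> ideal_power J m)"
  unfolding symbolic_power_def
  by (auto simp: Fract_in_extended_ideal_iff subspace_ideal_power Ass_def)

section \<open>The Stanley--Reisner ideal of a uniform matroid\<close>

definition set_monomial :: "'v set \<Rightarrow> 'v::finite \<Rightarrow>\<^sub>0 nat" where
  "set_monomial F = (\<Sum>i\<in>F. Poly_Mapping.single i 1)"

lemma lookup_set_monomial: "Poly_Mapping.lookup (set_monomial F) i = (if i \<in> F then 1 else 0)"
  by (simp add: set_monomial_def lookup_sum lookup_single when_def)

lemma keys_set_monomial [simp]: "Poly_Mapping.keys (set_monomial F) = F"
  by (auto simp: in_keys_iff lookup_set_monomial split: if_splits)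

lemma prod_single_one:
  "finite F \<Longrightarrow> (\<Prod>i\<in>F. Poly_Mapping.single (u i) (1::'k::comm_ring_1)) = Poly_Mapping.single (\<Sum>i\<in>F. u i) 1"
  by (induction F rule: finite_induct) (simp_all add: mult_single)

lemma prod_indet: "(\<Prod>i\<in>F. indet i) = Poly_Mapping.single (set_monomial F) (1::'k::comm_ring_1)"
  by (simp add: indet_def set_monomial_def prod_single_one)

lemma keys_add_nat:
  "Poly_Mapping.keys (s + t :: 'v \<Rightarrow>\<^sub>0 nat) = Poly_Mapping.keys s \<union> Poly_Mapping.keys t"
  by (auto simp: in_keys_iff lookup_add)

lemma poly_mapping_sum_single:
  "(\<Sum>t\<in>Poly_Mapping.keys f. Poly_Mapping.single t (Poly_Mapping.lookup f t)) = f"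
  by (rule poly_mapping_eqI) (auto simp: lookup_sum lookup_single when_def in_keys_iff)

text \<open>Multiplication by a monomial translates the exponents injectively, so no terms cancel
  and the support of the product is exactly the translated one.\<close>

lemma mult_single_in_weight_ideal_iff:
  fixes f :: "('v, 'k::comm_ring_1) mpoly_ring"
  shows "f * Poly_Mapping.single u 1 \<in> weight_ideal w m \<longleftrightarrow> (\<forall>t\<in>Poly_Mapping.keys f. m \<le> w (t + u))"
proof -
  have "Poly_Mapping.keys (f * Poly_Mapping.single u 1) = (\<lambda>t. t + u) ` Poly_Mapping.keys f"
  proof
    show "Poly_Mapping.keys (f * Poly_Mapping.single u 1) \<subseteq> (\<lambda>t. t + u) ` Poly_Mapping.keys f"
      using keys_mult[of f "Poly_Mapping.single u 1"] by (auto split: if_splits)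
    have "f = (\<Sum>t\<in>Poly_Mapping.keys f. Poly_Mapping.single t (Poly_Mapping.lookup f t))"
      by (rule poly_mapping_sum_single[symmetric])
    then have "f * Poly_Mapping.single u 1 =
        (\<Sum>t\<in>Poly_Mapping.keys f. Poly_Mapping.single (t + u) (Poly_Mapping.lookup f t))"
      by (metis (no_types, lifting) mult.right_neutral mult_single sum.cong sum_distrib_right)
    then have "Poly_Mapping.lookup (f * Poly_Mapping.single u 1) (s + u) = Poly_Mapping.lookup f s" for s
      by (auto simp: lookup_sum lookup_single when_def in_keys_iff)
    then show "(\<lambda>t. t + u) ` Poly_Mapping.keys f \<subseteq> Poly_Mapping.keys (f * Poly_Mapping.single u 1)"
      by (auto simp: in_keys_iff)
  qed
  then show ?thesis by (auto simp: weight_ideal_def)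
qed

lemma uniform_matroid_iff:
  fixes F :: "'v::finite set"
  assumes "r \<le> CARD('v)"
  shows "F \<in> uniform_matroid r \<longleftrightarrow> card F \<le> r"
proof
  assume "F \<in> uniform_matroid r"
  then show "card F \<le> r" by (auto simp: uniform_matroid_def intro: card_mono)
next
  assume "card F \<le> r"
  then obtain G where "F \<subseteq> G" "card G = r"
    using exists_subset_between[of F r UNIV] assms by auto
  then show "F \<in> uniform_matroid r" by (auto simp: uniform_matroid_def)
qed

text \<open>The generators involve more than \<open>r\<close> variables, and multiplication only
  enlarges supports. Conversely, a monomial in more than \<open>r\<close> variables is a multiple of
  the squarefree monomial on its support, which is a generator.\<close>

lemma stanley_reisner_ideal_uniform_matroid:
  assumes "r \<le> CARD('v)"
  shows "(stanley_reisner_ideal (uniform_matroid r) :: ('v::finite, 'k::comm_ring_1) mpoly_ring set)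
    = weight_ideal (\<lambda>t. card (Poly_Mapping.keys t)) (Suc r)" (is "?I = ?W")
proof
  have "ideal.subspace ?W"
    by (rule subspace_weight_ideal) (auto simp: keys_add_nat intro: card_mono)
  then show "?I \<subseteq> ?W"
    unfolding stanley_reisner_ideal_def
    by (intro ideal.span_minimal)
       (auto simp: prod_indet uniform_matroid_iff[OF assms] weight_ideal_def)
next
  show "?W \<subseteq> ?I"
  proof
    fix f :: "('v, 'k) mpoly_ring" assume f: "f \<in> ?W"
    have "f = (\<Sum>t\<in>Poly_Mapping.keys f. Poly_Mapping.single t (Poly_Mapping.lookup f t))"
      by (rule poly_mapping_sum_single[symmetric])
    also have "\<dots> \<in> ?I"
      unfolding stanley_reisner_ideal_def
    proof (rule ideal.span_sum)
      fix t assume t: "t \<in> Poly_Mapping.keys f"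
      let ?F = "Poly_Mapping.keys t"
      have "?F \<notin> uniform_matroid r"
        using f t by (auto simp: weight_ideal_def uniform_matroid_iff[OF assms])
      then have "Poly_Mapping.single (t - set_monomial ?F) (Poly_Mapping.lookup f t) * (\<Prod>i\<in>?F. indet i)
         \<in> ideal.span {(\<Prod>i\<in>F. indet i) |F. F \<notin> uniform_matroid r}"
        by (intro ideal.span_scale ideal.span_base) blast
      \<comment> \<open>The truncated subtraction is exact, as every variable in the support of
        \<open>t\<close> has exponent at least \<open>1\<close>.\<close>
      moreover have "t - set_monomial ?F + set_monomial ?F = t"
        by (rule poly_mapping_eqI)
           (auto simp: lookup_add lookup_minus lookup_set_monomial in_keys_iff)
      ultimately show "Poly_Mapping.single t (Poly_Mapping.lookup f t)
         \<in> ideal.span {(\<Prod>i\<in>F. indet i) |F. F \<notin> uniform_matroid r}"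
        by (simp add: prod_indet mult_single)
    qed
    finally show "f \<in> ?I" .
  qed
qed

lemma card_Compl: "card (- S) = CARD('v) - card S" for S :: "'v::finite set"
  by (simp add: Compl_eq_Diff_UNIV card_Diff_subset)

text \<open>For finite \<open>S\<close>, \<open>weight_ideal (subset_degree S) m\<close> is the
  \<open>m\<close>-th power of the ideal generated by the variables in \<open>S\<close>.\<close>

definition subset_degree :: "'v set \<Rightarrow> ('v \<Rightarrow>\<^sub>0 nat) \<Rightarrow> nat" where
  "subset_degree S t = (\<Sum>i\<in>S. Poly_Mapping.lookup t i)"

lemma subset_degree_add: "subset_degree S (s + t) = subset_degree S s + subset_degree S t"
  by (simp add: subset_degree_def lookup_add sum.distrib)

lemma subset_degree_pos_iff:
  "Suc 0 \<le> subset_degree S t \<longleftrightarrow> Poly_Mapping.keys t \<inter> S \<noteq> {}" for S :: "'v::finite set"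
proof -
  have "Suc 0 \<le> subset_degree S t \<longleftrightarrow> subset_degree S t \<noteq> 0" by linarith
  also have "\<dots> \<longleftrightarrow> Poly_Mapping.keys t \<inter> S \<noteq> {}"
    by (auto simp: subset_degree_def in_keys_iff)
  finally show ?thesis .
qed

lemma monomial_degree_eq_subset_degree: "monomial_degree t = subset_degree UNIV t"
  for t :: "'v::finite \<Rightarrow>\<^sub>0 nat"
  unfolding monomial_degree_def subset_degree_def
  by (rule sum.mono_neutral_left) (auto simp: in_keys_iff)

section \<open>Associated primes and symbolic powers of the ideal\<close>

context
  fixes c :: nat
    and I :: "('v::{finite,linorder}, 'k::idom) mpoly_ring set"
  assumes c: "1 \<le> c" "c \<le> CARD('v)"
    and I: "I = stanley_reisner_ideal (uniform_matroid (CARD('v) - c))"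
begin

lemma I_eq: "I = weight_ideal (\<lambda>t. card (Poly_Mapping.keys t)) (Suc (CARD('v) - c))"
  by (simp add: I stanley_reisner_ideal_uniform_matroid)

text \<open>Only \<open>CARD('v) - c\<close> variables lie outside \<open>S\<close>, so a larger
  support must meet \<open>S\<close>.\<close>

lemma I_subset_weight_ideal:
  assumes "card S = c"
  shows "I \<subseteq> weight_ideal (subset_degree S) 1"
proof -
  have "Poly_Mapping.keys t \<inter> S \<noteq> {}" if "Suc (CARD('v) - c) \<le> card (Poly_Mapping.keys t)"
    for t :: "'v \<Rightarrow>\<^sub>0 nat"
  proof
    assume "Poly_Mapping.keys t \<inter> S = {}"
    then have "card (Poly_Mapping.keys t) \<le> card (- S)" by (intro card_mono) auto
    then show False using that assms by (simp add: card_Compl)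
  qed
  then show ?thesis by (auto simp: I_eq weight_ideal_def subset_degree_pos_iff)
qed

text \<open>The prime is the annihilator of the class of the product of all variables outside
  \<open>S\<close>: multiplying that product by \<open>t\<close> pushes the support past
  \<open>CARD('v) - c\<close> exactly when \<open>t\<close> involves a variable of
  \<open>S\<close>.\<close>

lemma weight_ideal_in_Ass:
  assumes S: "card S = c"
  shows "weight_ideal (subset_degree S) 1 \<in> Ass I"
proof -
  let ?x = "Poly_Mapping.single (set_monomial (- S)) (1::'k)"
  have "Suc (CARD('v) - c) \<le> card (Poly_Mapping.keys t \<union> - S) \<longleftrightarrow> Poly_Mapping.keys t \<inter> S \<noteq> {}"
    for t :: "'v \<Rightarrow>\<^sub>0 nat"
  proof -
    have "Poly_Mapping.keys t \<union> - S = (Poly_Mapping.keys t \<inter> S) \<union> - S" by auto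
    also have "card \<dots> = card (Poly_Mapping.keys t \<inter> S) + (CARD('v) - c)"
      using S by (subst card_Un_disjoint) (auto simp: card_Compl)
    finally show ?thesis by (auto simp: Suc_le_eq card_gt_0_iff)
  qed
  then have "weight_ideal (subset_degree S) 1 = {g. g * ?x \<in> I}"
    by (simp add: I_eq mult_single_in_weight_ideal_iff keys_add_nat)
       (simp add: weight_ideal_def subset_degree_pos_iff)
  moreover have "prime_ideal (weight_ideal (subset_degree S) 1 :: ('v, 'k) mpoly_ring set)"
    by (rule prime_ideal_weight_ideal) (rule subset_degree_add)
  ultimately show ?thesis unfolding Ass_def by blast
qed

text \<open>Localising at this prime supplies a multiplier \<open>s\<close> outside it. Such an
  \<open>s\<close> vanishes to order \<open>0\<close> along it, so \<open>s * f\<close> and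
  \<open>f\<close> have the same order.\<close>

lemma symbolic_power_subset_weight_ideal:
  assumes S: "card S = c"
  shows "symbolic_power I m \<subseteq> weight_ideal (subset_degree S) m"
proof
  fix f assume "f \<in> symbolic_power I m"
  then obtain s where s: "s \<notin> weight_ideal (subset_degree S) 1" "s * f \<in> ideal_power I m"
    using weight_ideal_in_Ass[OF S] by (auto simp: mem_symbolic_power_iff)
  have "s * f \<in> weight_ideal (subset_degree S) m"
    using s(2) ideal_power_subset_weight_ideal[OF subset_degree_add I_subset_weight_ideal[OF S]]
    by blast
  then show "f \<in> weight_ideal (subset_degree S) m"
    using weight_ideal_cancel[OF subset_degree_add s(1)] by blast
qed

lemma card_indets_in_Ass:
  assumes P: "P \<in> Ass I"
  shows "card {i. indet i \<in> P} = c"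
proof (rule antisym)
  let ?T = "{i. indet i \<in> P}"
  from P obtain f where pP: "prime_ideal P" and Pf: "P = {g. g * f \<in> I}"
    unfolding Ass_def by blast
  \<comment> \<open>As \<open>1 * f\<close> is not in \<open>I\<close>, some monomial
    \<open>t\<close> of \<open>f\<close> has too small a support.\<close>
  have "1 \<notin> P" using prime_ideal_prod[OF pP, of "{}"] by simp
  then obtain t where t: "t \<in> Poly_Mapping.keys f" "card (Poly_Mapping.keys t) \<le> CARD('v) - c"
    by (auto simp: Pf I_eq weight_ideal_def not_le)
  show "card ?T \<le> c"
  proof (cases "?T = {}")
    case False
    \<comment> \<open>Multiplying by \<open>indet i\<close> has to lift the support of
      \<open>t\<close> above \<open>CARD('v) - c\<close>; hence \<open>i\<close> is a new variable
      and the support was already of that size.\<close>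
    have T: "i \<notin> Poly_Mapping.keys t \<and> CARD('v) - c \<le> card (Poly_Mapping.keys t)" if "i \<in> ?T" for i
    proof -
      have "f * indet i \<in> I" using that by (simp add: Pf mult.commute)
      then have "Suc (CARD('v) - c) \<le> card (Poly_Mapping.keys t \<union> {i})"
        using t(1) by (auto simp: I_eq indet_def mult_single_in_weight_ideal_iff keys_add_nat
          simp del: Un_insert_right)
      then show ?thesis using t(2)
        by (cases "i \<in> Poly_Mapping.keys t") (simp_all add: insert_absorb)
    qed
    then have "?T \<subseteq> - Poly_Mapping.keys t" by blast
    then have "card ?T \<le> CARD('v) - card (Poly_Mapping.keys t)"
      using card_mono[of "- Poly_Mapping.keys t" ?T] by (simp add: card_Compl)
    moreover obtain i where "i \<in> ?T" using False by blast
    then have "CARD('v) - c \<le> card (Poly_Mapping.keys t)" using T by blast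
    ultimately show ?thesis using c by linarith
  qed simp
  show "c \<le> card ?T"
  proof (rule ccontr)
    assume "\<not> c \<le> card ?T"
    \<comment> \<open>With fewer than \<open>c\<close> variables in \<open>P\<close>, the product of
      the others would lie in \<open>I\<close> and so in \<open>P\<close>, against
      primality.\<close>
    then have "Suc (CARD('v) - c) \<le> card (- ?T)" using c by (simp add: card_Compl)
    then have "(\<Prod>i\<in>- ?T. indet i) \<in> I" by (simp add: prod_indet I_eq weight_ideal_def)
    moreover have "f * g \<in> I" if "g \<in> I" for g
      using that unfolding I stanley_reisner_ideal_def by (rule ideal.span_scale)
    then have "I \<subseteq> P" by (auto simp: Pf mult.commute)
    moreover have "(\<Prod>i\<in>- ?T. indet i) \<notin> P"
      by (rule prime_ideal_prod[OF pP]) auto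
    ultimately show False by blast
  qed
qed

text \<open>With \<open>T\<close> the variables in \<open>P\<close> and \<open>u\<close> the product of the other ones, which is a unit at \<open>P\<close>,
  each \<open>x\<^sub>i u\<close> with \<open>i \<in> T\<close> lies in \<open>I\<close>; there are \<open>c\<close> such elements.\<close>

lemma prod_indet_power_in_symbolic_power:
  assumes "m \<le> c * q"
  shows "(\<Prod>i\<in>UNIV. indet i) ^ q \<in> symbolic_power I m"
  unfolding mem_symbolic_power_iff
proof
  fix P assume P: "P \<in> Ass I"
  then have pP: "prime_ideal P" by (auto simp: Ass_def)
  define T where "T = {i. indet i \<in> P}"
  define u where "u = (\<Prod>i\<in>- T. indet i :: ('v, 'k) mpoly_ring)"
  have cardT: "card T = c" unfolding T_def using P by (rule card_indets_in_Ass)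
  have "u \<notin> P" unfolding u_def by (rule prime_ideal_prod[OF pP]) (auto simp: T_def)
  \<comment> \<open>This constant product is \<open>u ^ (c * q)\<close>, the multiplier chosen at
    the end.\<close>
  then have u: "(\<Prod>i\<in>{..<c * q}. u) \<notin> P" by (intro prime_ideal_prod[OF pP]) auto
  have "indet i * u \<in> I" if "i \<in> T" for i
  proof -
    have "indet i * u = (\<Prod>i\<in>insert i (- T). indet i)" using that by (simp add: u_def)
    moreover have "card (insert i (- T)) = Suc (CARD('v) - c)"
      using that cardT by (simp add: card_Compl)
    ultimately show ?thesis by (simp add: prod_indet I_eq weight_ideal_def)
  qed
  then have "(\<Prod>i\<in>T. (indet i * u) ^ q) \<in> ideal_power I (card T * q)"
    by (intro prod_power_in_ideal_power) auto
  then have "(\<Prod>i\<in>T. (indet i * u) ^ q) \<in> ideal_power I m"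
    using ideal_power_antimono[OF assms, of I] cardT by auto
  \<comment> \<open>The product over \<open>T\<close> contains only the variables of
    \<open>T\<close> to the power \<open>q\<close>, times \<open>u ^ (c * q)\<close>; the extra
    \<open>u ^ q\<close> supplies the remaining variables.\<close>
  then have "u ^ q * (\<Prod>i\<in>T. (indet i * u) ^ q) \<in> ideal_power I m"
    by (rule ideal.subspace_scale[OF subspace_ideal_power])
  moreover have "(\<Prod>i\<in>UNIV. indet i) = (\<Prod>i\<in>T. indet i) * u"
    unfolding u_def by (subst prod.union_disjoint[symmetric]) (auto simp: Compl_partition)
  then have "u ^ q * (\<Prod>i\<in>T. (indet i * u) ^ q) = u ^ (c * q) * (\<Prod>i\<in>UNIV. indet i) ^ q"
    by (simp add: prod_power_distrib prod.distrib power_mult_distrib cardT power_mult[symmetric] mult_ac)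
  ultimately show "\<exists>s. s \<notin> P \<and> s * (\<Prod>i\<in>UNIV. indet i) ^ q \<in> ideal_power I m"
    using u by (auto intro!: exI[of _ "u ^ (c * q)"])
qed

section \<open>Averaging over subsets, degree bounds and the limit\<close>

lemma le_monomial_degree:
  assumes "\<And>S. card S = c \<Longrightarrow> m \<le> subset_degree S t"
  shows "CARD('v) * m \<le> c * monomial_degree (t :: 'v \<Rightarrow>\<^sub>0 nat)"
proof -
  let ?N = "CARD('v)"
  let ?\<S> = "{S :: 'v set. card S = c}"
  have star: "card {S \<in> ?\<S>. i \<in> S} = (?N - 1) choose (c - 1)" for i
  proof -
    \<comment> \<open>The sets of size \<open>c\<close> through \<open>i\<close> correspond to the
      sets of size \<open>c - 1\<close> avoiding \<open>i\<close>; \<open>1 \<le> c\<close> makes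
      the subtraction exact.\<close>
    have "bij_betw (insert i) {A. A \<subseteq> - {i} \<and> card A = c - 1} {S \<in> ?\<S>. i \<in> S}"
      by (rule bij_betwI[where g = "\<lambda>S. S - {i}"])
         (use c in \<open>auto simp: card_insert_if finite_subset insert_absorb\<close>)
    then show ?thesis
      using n_subsets[of "- {i}" "c - 1"] by (simp add: bij_betw_same_card[symmetric] card_Compl)
  qed
  \<comment> \<open>Double counting: sum the hypothesis over all sets of size \<open>c\<close>, then
    count how often each variable occurs.\<close>
  have "(?N choose c) * m = (\<Sum>S\<in>?\<S>. m)" using n_subsets[of "UNIV :: 'v set" c] by simp
  also have "\<dots> \<le> (\<Sum>S\<in>?\<S>. subset_degree S t)" using assms by (intro sum_mono) auto
  also have "\<dots> = (\<Sum>S\<in>?\<S>. \<Sum>i\<in>UNIV. if i \<in> S then Poly_Mapping.lookup t i else 0)"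
    by (simp add: subset_degree_def sum.If_cases)
  also have "\<dots> = (\<Sum>i\<in>UNIV. \<Sum>S\<in>?\<S>. if i \<in> S then Poly_Mapping.lookup t i else 0)"
    by (rule sum.swap)
  also have "\<dots> = (\<Sum>i\<in>UNIV. ((?N - 1) choose (c - 1)) * Poly_Mapping.lookup t i)"
    by (intro sum.cong refl) (simp add: sum.If_cases Int_def star[simplified])
  also have "\<dots> = ((?N - 1) choose (c - 1)) * monomial_degree t"
    by (simp add: monomial_degree_eq_subset_degree subset_degree_def sum_distrib_left)
  finally have "c * ((?N choose c) * m) \<le> c * (((?N - 1) choose (c - 1)) * monomial_degree t)"
    by simp
  \<comment> \<open>Absorption identity: it makes the positive factor
    \<open>(?N - 1) choose (c - 1)\<close> common to both sides, where it cancels.\<close>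
  moreover have "c * (?N choose c) = ?N * ((?N - 1) choose (c - 1))"
    using c times_binomial_minus1_eq by simp
  ultimately have "((?N - 1) choose (c - 1)) * (?N * m) \<le> ((?N - 1) choose (c - 1)) * (c * monomial_degree t)"
    by (metis mult.assoc mult.left_commute)
  moreover have "0 < (?N - 1) choose (c - 1)" using c by simp
  ultimately show ?thesis by simp
qed

lemma le_total_degree_symbolic_power:
  assumes "f \<in> symbolic_power I m" "f \<noteq> 0"
  shows "CARD('v) * m \<le> c * total_degree f"
proof -
  obtain t where t: "t \<in> Poly_Mapping.keys f" using assms(2) by (meson ex_in_conv keys_eq_empty)
  have "CARD('v) * m \<le> c * monomial_degree t"
    using symbolic_power_subset_weight_ideal assms(1) t
    by (intro le_monomial_degree) (auto simp: weight_ideal_def)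
  also have "monomial_degree t \<le> total_degree f"
    unfolding total_degree_def using t by (intro Max_ge) auto
  finally show ?thesis by simp
qed

lemma alpha_symbolic_power_bounds:
  shows "CARD('v) * m \<le> c * alpha (symbolic_power I m)"
    and "alpha (symbolic_power I m) \<le> CARD('v) * (m div c + 1)"
proof -
  \<comment> \<open>This \<open>q\<close> satisfies \<open>m \<le> c * q\<close> and exceeds
    \<open>m / c\<close> by at most \<open>1\<close>, an error that disappears after division by
    \<open>m\<close>.\<close>
  define q where "q = m div c + 1"
  let ?x = "(\<Prod>i\<in>UNIV. indet i :: ('v, 'k) mpoly_ring) ^ q"
  let ?u = "\<Sum>i<q. set_monomial (UNIV :: 'v set)"
  have "m mod c < c" using c by simp
  then have "m \<le> c * q" unfolding q_def
    by (metis add_mult_distrib2 less_imp_le mult.right_neutral mult_div_mod_eq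
        nat_add_left_cancel_le)
  then have "?x \<in> symbolic_power I m" by (rule prod_indet_power_in_symbolic_power)
  moreover have x: "?x = Poly_Mapping.single ?u 1"
    using prod_single_one[of "{..<q}" "\<lambda>_. set_monomial (UNIV :: 'v set)", where 'k = 'k]
    by (simp only: prod_indet prod_constant card_lessThan finite_lessThan)
  moreover have "total_degree ?x = CARD('v) * q"
    by (simp add: x total_degree_def monomial_degree_eq_subset_degree subset_degree_def
        lookup_sum lookup_set_monomial)
  ultimately have ex: "\<exists>f\<in>symbolic_power I m. f \<noteq> 0 \<and> total_degree f = CARD('v) * q"
    by (metis lookup_single_eq lookup_zero zero_neq_one)
  then show "alpha (symbolic_power I m) \<le> CARD('v) * (m div c + 1)"
    unfolding alpha_def q_def by (rule Least_le)
  \<comment> \<open>The element just exhibited ensures that the least degree is attained, so the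
    bound for all nonzero elements applies to \<open>alpha\<close>.\<close>
  from LeastI[of "\<lambda>d. \<exists>f\<in>symbolic_power I m. f \<noteq> 0 \<and> total_degree f = d", OF ex]
  show "CARD('v) * m \<le> c * alpha (symbolic_power I m)"
    using le_total_degree_symbolic_power unfolding alpha_def by metis
qed

lemma waldschmidt_seq_tendsto: "waldschmidt_seq I \<longlonglongrightarrow> real CARD('v) / real c"
proof (rule tendsto_sandwich)
  let ?N = "real CARD('v)"
  show "\<forall>\<^sub>F m in sequentially. ?N / c \<le> waldschmidt_seq I m"
    \<comment> \<open>The index \<open>0\<close> must be excluded: division by zero makes that term
      \<open>0\<close>, below the claimed bound.\<close>
    using eventually_gt_at_top[of 0]
  proof eventually_elim
    case (elim m)
    have "?N * real m \<le> real c * real (alpha (symbolic_power I m))"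
      using alpha_symbolic_power_bounds(1)[of m] by (metis of_nat_le_iff of_nat_mult)
    then show ?case using elim c by (simp add: waldschmidt_seq_def field_simps)
  qed
  show "\<forall>\<^sub>F m in sequentially. waldschmidt_seq I m \<le> ?N / c + ?N * (1 / real m)"
    using eventually_gt_at_top[of 0]
  proof eventually_elim
    case (elim m)
    have "real (alpha (symbolic_power I m)) \<le> ?N * (real (m div c) + 1)"
      using alpha_symbolic_power_bounds(2)[of m] by (metis of_nat_le_iff of_nat_mult of_nat_add of_nat_1)
    also have "\<dots> \<le> ?N * (real m / real c + 1)"
      by (intro mult_left_mono add_right_mono of_nat_div_le_of_nat) auto
    finally have "real (alpha (symbolic_power I m)) / real m \<le> ?N * (real m / real c + 1) / real m"
      by (rule divide_right_mono) simp
    also have "\<dots> = ?N / c + ?N * (1 / real m)" using elim c by (simp add: field_simps)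
    finally show ?case by (simp add: waldschmidt_seq_def)
  qed
  show "(\<lambda>m. ?N / c + ?N * (1 / real m)) \<longlonglongrightarrow> ?N / c"
    using tendsto_add[OF tendsto_const tendsto_mult_right_zero[OF lim_1_over_n]] by force
qed simp

end

theorem theorem7p5:
  fixes n c :: nat
    and I :: "('v::{finite,linorder}, 'k::alg_closed_field) mpoly_ring set"
  assumes "CARD('v) = n + 1" and "1 \<le> c" and "c \<le> n + 1"
    and "I = stanley_reisner_ideal (uniform_matroid (n + 1 - c))"
  shows "convergent (waldschmidt_seq I) \<and>
         waldschmidt_constant I = real (n + 1) / real c"
proof -
  have "waldschmidt_seq I \<longlonglongrightarrow> real (n + 1) / real c"
    using waldschmidt_seq_tendsto[of c I] assms by simp
  \<comment> \<open>\<open>lim\<close> is a definite description; its value comes from convergence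
    and uniqueness of limits.\<close>
  then show ?thesis
    unfolding waldschmidt_constant_def by (auto intro: convergentI limI)
qed

end
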